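(* For every function $\theta:\Sigma^+\to\mathbb{N}\setminus\{0,1\}$, there exists a $\theta$-NMDA if and only if there exists a transducer $\mathcal{T}$ with $\mathcal{T}(u)=\theta(u)$ for all $u\in\Sigma^+$.
   Context: An alphabet $\Sigma$ is a finite nonempty set; $\Sigma^+$ denotes nonempty finite words. An NMDA is a tuple $\mathcal{A}=\langle \Sigma,Q,\iota,\delta,\gamma,\rho\rangle$ with finite state set $Q$, initial states $\iota\subseteq Q$, transition relation $\delta\subseteq Q\times\Sigma\times Q$, weight function $\gamma:\delta\to\mathbb{Q}$ and discount-factor function $\rho:\delta\to\mathbb{Q}\cap(1,\infty)$; NMDAs are assumed complete (every state has at least one outgoing transition on every letter). A run of $\mathcal{A}$ on $u=\sigma_1\cdots\sigma_n$ is a sequence $q_0,\sigma_1,q_1,\ldots,\sigma_n,q_n$ with $q_0\in\iota$ and $(q_{i-1},\sigma_i,q_i)\in\delta$. An NMDA is integral if all discount factors are integers. An integral NMDA $\mathcal{A}$ is a $\theta$-NMDA if for every $u=\sigma_1\cdots\sigma_n\in\Sigma^+$ and every run $q_0,\sigma_1,\ldots,q_n$ of $\mathcal{A}$ on $u$ we have $\rho(q_{n-1},\sigma_n,q_n)=\theta(u)$. A transducer (Mealy machine) with output in $\mathbb{N}$ is a tuple $\mathcal{T}=\langle P,\Sigma,p_0,\delta,\rho\rangle$ with finite state set $P$, initial state $p_0$, total transition function $\delta:P\times\Sigma\to P$ and total output function $\rho:P\times\Sigma\to\mathbb{N}$; for $w\in\Sigma^+$, $\mathcal{T}(w)$ is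 the output of the last transition taken when running $\mathcal{T}$ on $w$ from $p_0$.
   Formalization: The set of initial states of an NMDA is required to be nonempty; with no initial state there are no runs, so every θ would vacuously have a θ-NMDA and the claim would fail. State sets, being finite, are taken as sets of natural numbers. *)

theory Defs
  imports Complex_Main
begin

text \<open>
  Words over \<open>\<Sigma>\<close> are lists. The alphabet is a component of the automaton, as in the
  tuple notation; \<open>\<gamma>\<close> and \<open>\<rho>\<close> are total functions on triples of which only the values on
  the transition relation matter. State sets are finite, so a claim that some automaton or
  transducer exists can be stated with states of type \<^typ>\<open>nat\<close> without loss of generality.
\<close>

definition nonempty_words :: "'a set \<Rightarrow> 'a list set" where
  "nonempty_words \<Sigma> = {u. u \<noteq> [] \<and> set u \<subseteq> \<Sigma>}"

record ('a, 'q) nmda =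
  alphabet :: "'a set"
  states :: "'q set"
  initial :: "'q set"
  trans_rel :: "('q \<times> 'a \<times> 'q) set"
  weight :: "'q \<times> 'a \<times> 'q \<Rightarrow> rat"
  discount :: "'q \<times> 'a \<times> 'q \<Rightarrow> rat"

text \<open>
  Completeness is meant to guarantee a run on every word, so it includes the existence of an
  initial state. Without one there are no runs at all, and the automaton would vacuously be a
  \<open>\<theta>\<close>-NMDA for every \<open>\<theta>\<close>.
\<close>

definition is_nmda :: "('a, 'q) nmda \<Rightarrow> bool" where
  "is_nmda A \<longleftrightarrow>
     finite (alphabet A) \<and> alphabet A \<noteq> {} \<and>
     finite (states A) \<and>
     initial A \<subseteq> states A \<and> initial A \<noteq> {} \<and>
     trans_rel A \<subseteq> states A \<times> alphabet A \<times> states A \<and>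
     (\<forall>t\<in>trans_rel A. discount A t > 1) \<and>
     (\<forall>q\<in>states A. \<forall>\<sigma>\<in>alphabet A. \<exists>q'. (q, \<sigma>, q') \<in> trans_rel A)"

text \<open>A run \<open>q\<^sub>0, \<sigma>\<^sub>1, q\<^sub>1, \<dots>, \<sigma>\<^sub>n, q\<^sub>n\<close> on a given word is represented by
  its list of states \<open>[q\<^sub>0, \<dots>, q\<^sub>n]\<close>; the letter \<open>\<sigma>\<^sub>i\<close> is \<open>u ! (i - 1)\<close>.\<close>

definition is_run :: "('a, 'q) nmda \<Rightarrow> 'a list \<Rightarrow> 'q list \<Rightarrow> bool" where
  "is_run A u qs \<longleftrightarrow>
     length qs = Suc (length u) \<and>
     qs ! 0 \<in> initial A \<and>
     (\<forall>i<length u. (qs ! i, u ! i, qs ! Suc i) \<in> trans_rel A)"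

definition integral_nmda :: "('a, 'q) nmda \<Rightarrow> bool" where
  "integral_nmda A \<longleftrightarrow> is_nmda A \<and> (\<forall>t\<in>trans_rel A. discount A t \<in> \<int>)"

definition theta_nmda :: "('a list \<Rightarrow> nat) \<Rightarrow> ('a, 'q) nmda \<Rightarrow> bool" where
  "theta_nmda \<theta> A \<longleftrightarrow>
     integral_nmda A \<and>
     (\<forall>u\<in>nonempty_words (alphabet A). \<forall>qs. is_run A u qs \<longrightarrow>
        discount A (qs ! (length u - 1), last u, qs ! length u) = of_nat (\<theta> u))"

record ('a, 'p) transducer =
  t_states :: "'p set"
  t_alphabet :: "'a set"
  t_init :: 'p
  t_step :: "'p \<Rightarrow> 'a \<Rightarrow> 'p"
  t_out :: "'p \<Rightarrow> 'a \<Rightarrow> nat"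

definition is_transducer :: "('a, 'p) transducer \<Rightarrow> bool" where
  "is_transducer T \<longleftrightarrow>
     finite (t_alphabet T) \<and> t_alphabet T \<noteq> {} \<and>
     finite (t_states T) \<and> t_init T \<in> t_states T \<and>
     (\<forall>p\<in>t_states T. \<forall>\<sigma>\<in>t_alphabet T. t_step T p \<sigma> \<in> t_states T)"

text \<open>Output of the last transition; meaningful for nonempty \<open>w\<close> only.\<close>

definition transduce :: "('a, 'p) transducer \<Rightarrow> 'a list \<Rightarrow> nat" where
  "transduce T w = t_out T (foldl (t_step T) (t_init T) (butlast w)) (last w)"

end

theory Submission
  imports Defs
begin

text \<open>
  All runs of a \<open>\<theta>\<close>-NMDA on a word agree on the last discount factor, so it may be pruned to one
  initial state and one successor per state and letter; reading discount factors as outputs, the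
  result is a transducer for \<open>\<theta>\<close>. Conversely a transducer is a deterministic NMDA, but its
  unreachable states have to be dropped, since outputs there are not constrained to exceed 1.
\<close>

lemma foldl_closed:
  assumes "p \<in> S" and "\<And>q a. q \<in> S \<Longrightarrow> a \<in> \<Sigma> \<Longrightarrow> f q a \<in> S" and "set w \<subseteq> \<Sigma>"
  shows "foldl f p w \<in> S"
  using assms(1,3) by (induction w arbitrary: p) (auto intro: assms(2))

text \<open>Since \<open>f\<close> is only known to choose transitions from states in
  \<open>S\<close>, \<open>foldl_closed\<close> is applied first to keep every prefix inside
  \<open>S\<close>. This supplies the one run that a pruned automaton follows.\<close>

lemma foldl_run:
  assumes "q \<in> initial A" and "q \<in> S" and "set u \<subseteq> \<Sigma>"
    and "\<And>p a. p \<in> S \<Longrightarrow> a \<in> \<Sigma> \<Longrightarrow> f p a \<in> S \<and> (p, a, f p a) \<in> trans_rel A"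
  shows "is_run A u (map (\<lambda>i. foldl f q (take i u)) [0..<Suc (length u)])"
proof -
  have "(foldl f q (take i u), u ! i, foldl f q (take (Suc i) u)) \<in> trans_rel A"
    if "i < length u" for i
  proof -
    have "set (take i u) \<subseteq> \<Sigma>" "u ! i \<in> \<Sigma>"
      using assms(3) that set_take_subset[of i u] by auto
    then show ?thesis
      using assms(2,4) foldl_closed[of q S \<Sigma> f "take i u"] that
      by (simp add: take_Suc_conv_app_nth)
  qed
  then show ?thesis
    using assms(1) by (simp add: is_run_def nth_append del: upt_Suc)
qed

text \<open>The single initial state fixes the start, and functionality of
  \<open>trans_rel A\<close> then fixes each next state. Any run is thus the folded one, which pins
  down the source of the last transition.\<close>

lemma deterministic_run_nth:
  assumes "is_run A u qs" and "initial A = {q}"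
    and "\<And>p a p'. (p, a, p') \<in> trans_rel A \<Longrightarrow> p' = f p a"
    and "i \<le> length u"
  shows "qs ! i = foldl f q (take i u)"
  using assms(4)
proof (induction i)
  case 0
  then show ?case using assms(1,2) by (simp add: is_run_def)
next
  case (Suc i)
  then have "(qs ! i, u ! i, qs ! Suc i) \<in> trans_rel A"
    using assms(1) unfolding is_run_def by (metis Suc_le_eq)
  then have "qs ! Suc i = f (qs ! i) (u ! i)"
    by (rule assms(3))
  then show ?case
    using Suc by (simp add: take_Suc_conv_app_nth)
qed

text \<open>\<open>theta_nmda\<close> constrains all runs, hence in particular the run that starts
  in a chosen \<open>q\<close> and always takes the successor chosen by \<open>f\<close>.\<close>

lemma transducer_of_theta_nmda:
  fixes A :: "('a, 'q) nmda"
  assumes "theta_nmda \<theta> A"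
  obtains T :: "('a, 'q) transducer"
  where "t_alphabet T = alphabet A" "is_transducer T"
    "\<forall>u\<in>nonempty_words (alphabet A). transduce T u = \<theta> u"
proof -
  have A: "is_nmda A"
    using assms by (simp add: theta_nmda_def integral_nmda_def)
  then obtain q where q: "q \<in> initial A" "q \<in> states A"
    by (auto simp: is_nmda_def)
  obtain f where f: "\<And>p a. p \<in> states A \<Longrightarrow> a \<in> alphabet A \<Longrightarrow> (p, a, f p a) \<in> trans_rel A"
    using A unfolding is_nmda_def by metis
  have closed: "f p a \<in> states A" if "p \<in> states A" "a \<in> alphabet A" for p a
    using f[OF that] A by (auto simp: is_nmda_def)
  \<comment> \<open>\<open>nat\<close> of the floor only changes the type from \<open>rat\<close> to
    \<open>nat\<close>: on the last transition of the chosen run the discount factor is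
    \<open>of_nat (\<theta> u)\<close>, so nothing is rounded.\<close>
  define T where "T = \<lparr>t_states = states A, t_alphabet = alphabet A, t_init = q, t_step = f,
    t_out = (\<lambda>p a. nat \<lfloor>discount A (p, a, f p a)\<rfloor>)\<rparr>"
  have "is_transducer T"
    using A q closed by (auto simp: is_transducer_def is_nmda_def T_def)
  moreover have "transduce T u = \<theta> u" if u: "u \<in> nonempty_words (alphabet A)" for u
  proof -
    define qs where "qs = map (\<lambda>i. foldl f q (take i u)) [0..<Suc (length u)]"
    \<comment> \<open>Splitting off the last letter matches \<open>butlast\<close> and
      \<open>last\<close> in \<open>transduce\<close> with the positions \<open>length u - 1\<close>
      and \<open>length u\<close> of the run.\<close>
    obtain v a where u_eq: "u = v @ [a]" and "set u \<subseteq> alphabet A"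
      using u by (cases u rule: rev_cases) (auto simp: nonempty_words_def)
    then have "is_run A u qs"
      unfolding qs_def using q f closed by (intro foldl_run[where S = "states A" and \<Sigma> = "alphabet A"]) auto
    then have "discount A (qs ! (length u - 1), last u, qs ! length u) = of_nat (\<theta> u)"
      using assms u by (simp add: theta_nmda_def)
    moreover have "qs ! i = foldl f q (take i u)" if "i \<le> length u" for i
      unfolding qs_def using that by (simp add: nth_append del: upt_Suc)
    ultimately show ?thesis
      by (simp add: u_eq transduce_def T_def)
  qed
  ultimately show ?thesis
    using that[of T] by (simp add: T_def)
qed

text \<open>Each run of the automaton built here is the path of \<open>T\<close> on the same word,
  and its discount factors are the outputs of \<open>T\<close> along that path.\<close>

lemma theta_nmda_of_transducer:
  fixes T :: "('a, 'p) transducer"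
  assumes T: "is_transducer T"
    and out: "\<forall>u\<in>nonempty_words (t_alphabet T). transduce T u = \<theta> u"
    and gt: "\<forall>u\<in>nonempty_words (t_alphabet T). \<theta> u > 1"
  obtains A :: "('a, 'p) nmda" where "alphabet A = t_alphabet T" "theta_nmda \<theta> A"
proof -
  \<comment> \<open>The reachable states; admitting the empty word puts \<open>t_init T\<close>
    among them.\<close>
  define R where "R = foldl (t_step T) (t_init T) ` {w. set w \<subseteq> t_alphabet T}"
  have "R \<subseteq> t_states T"
  proof -
    have "foldl (t_step T) (t_init T) w \<in> t_states T" if "set w \<subseteq> t_alphabet T" for w
      using T that foldl_closed[of "t_init T" "t_states T" "t_alphabet T" "t_step T"]
      unfolding is_transducer_def by blast
    then show ?thesis by (auto simp: R_def)
  qed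
  then have fin: "finite R"
    using T finite_subset unfolding is_transducer_def by blast
  have init: "t_init T \<in> R"
    unfolding R_def by (rule image_eqI[of _ _ "[]"]) auto
  have step: "t_step T p a \<in> R" if "p \<in> R" "a \<in> t_alphabet T" for p a
  proof -
    obtain w where "set w \<subseteq> t_alphabet T" "p = foldl (t_step T) (t_init T) w"
      using \<open>p \<in> R\<close> by (auto simp: R_def)
    then show ?thesis
      unfolding R_def using that by (intro image_eqI[of _ _ "w @ [a]"]) auto
  qed
  \<comment> \<open>A transition leaving a reachable state is the last one on some nonempty word
    \<open>w @ [a]\<close>, so its output is a value of \<open>\<theta>\<close>.\<close>
  have out_gt: "t_out T p a > 1" if "p \<in> R" "a \<in> t_alphabet T" for p a
  proof -
    obtain w where w: "set w \<subseteq> t_alphabet T" "p = foldl (t_step T) (t_init T) w"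
      using \<open>p \<in> R\<close> by (auto simp: R_def)
    then have "w @ [a] \<in> nonempty_words (t_alphabet T)"
      using that by (simp add: nonempty_words_def)
    then have "transduce T (w @ [a]) > 1"
      using out gt by simp
    then show ?thesis using w by (simp add: transduce_def)
  qed
  define A :: "('a, 'p) nmda" where "A = \<lparr>alphabet = t_alphabet T, states = R,
    initial = {t_init T}, trans_rel = {(p, a, t_step T p a) | p a. p \<in> R \<and> a \<in> t_alphabet T},
    weight = (\<lambda>_. 0), discount = (\<lambda>(p, a, _). of_nat (t_out T p a))\<rparr>"
  have "integral_nmda A"
    using T fin init step out_gt by (auto simp: integral_nmda_def is_nmda_def is_transducer_def A_def)
  moreover have "discount A (qs ! (length u - 1), last u, qs ! length u) = of_nat (\<theta> u)"
    if u: "u \<in> nonempty_words (alphabet A)" and run: "is_run A u qs" for u qs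
  proof -
    \<comment> \<open>\<open>discount A\<close> reads only source and letter, so locating the source
      of the last transition suffices; the prefix of length \<open>length u - 1\<close> is
      \<open>butlast u\<close>.\<close>
    have "qs ! (length u - 1) = foldl (t_step T) (t_init T) (take (length u - 1) u)"
      by (rule deterministic_run_nth[OF run]) (auto simp: A_def)
    then have "discount A (qs ! (length u - 1), last u, qs ! length u) = of_nat (transduce T u)"
      by (simp add: A_def transduce_def butlast_conv_take)
    then show ?thesis
      using out u by (simp add: A_def)
  qed
  ultimately have "theta_nmda \<theta> A"
    by (simp add: theta_nmda_def)
  then show ?thesis
    using that[of A] by (simp add: A_def)
qed

theorem theorem4p7:
  fixes \<Sigma> :: "'a set" and \<theta> :: "'a list \<Rightarrow> nat"
  assumes "finite \<Sigma>" and "\<Sigma> \<noteq> {}"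
    and "\<forall>u\<in>nonempty_words \<Sigma>. \<theta> u \<notin> {0, 1}"
  shows "(\<exists>A :: ('a, nat) nmda. alphabet A = \<Sigma> \<and> theta_nmda \<theta> A) \<longleftrightarrow>
         (\<exists>T :: ('a, nat) transducer. t_alphabet T = \<Sigma> \<and> is_transducer T \<and>
            (\<forall>u\<in>nonempty_words \<Sigma>. transduce T u = \<theta> u))"
proof -
  have gt: "\<forall>u\<in>nonempty_words \<Sigma>. \<theta> u > 1"
    using assms(3) by (metis One_nat_def insertCI nat_neq_iff less_one)
  \<comment> \<open>Both constructions keep the type of states, so instantiating it to
    \<open>nat\<close> gives each direction without renaming states.\<close>
  show ?thesis
  proof
    assume "\<exists>A :: ('a, nat) nmda. alphabet A = \<Sigma> \<and> theta_nmda \<theta> A"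
    then show "\<exists>T :: ('a, nat) transducer. t_alphabet T = \<Sigma> \<and> is_transducer T \<and>
      (\<forall>u\<in>nonempty_words \<Sigma>. transduce T u = \<theta> u)"
      by (elim exE conjE) (erule transducer_of_theta_nmda, blast)
  next
    assume "\<exists>T :: ('a, nat) transducer. t_alphabet T = \<Sigma> \<and> is_transducer T \<and>
      (\<forall>u\<in>nonempty_words \<Sigma>. transduce T u = \<theta> u)"
    then obtain T :: "('a, nat) transducer" where T: "t_alphabet T = \<Sigma>" "is_transducer T"
      "\<forall>u\<in>nonempty_words \<Sigma>. transduce T u = \<theta> u"
      by blast
    obtain A :: "('a, nat) nmda" where "alphabet A = t_alphabet T" "theta_nmda \<theta> A"
      using theta_nmda_of_transducer[of T \<theta>] T gt by auto
    then show "\<exists>A :: ('a, nat) nmda. alphabet A = \<Sigma> \<and> theta_nmda \<theta> A"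
      using T(1) by blast
  qed
qed

end
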